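(* Let $\mathfrak{g}$ be a finite-dimensional real Lie algebra, and endow $\mathfrak{g}^*$ with its Lie--Poisson structure and the scaling action $\Phi_s(\mu)=s\mu$, $s\in\mathbb{R}^+$. The following are equivalent. (1) There exist a homogeneous Hamiltonian $H\in C^\infty(\mathfrak{g}^* )$ of some degree $b$ and a nonzero point $\mu_e\in\mathfrak{g}^*$ that is a nontrivial conformal relative equilibrium for $H$ with velocity $\xi\neq0$. (2) There exist $\zeta\in\mathfrak{g}$, $\mu\in\mathfrak{g}^*\setminus\{0\}$, and $\xi\in\mathbb{R}\setminus\{0\}$ such that $\mathrm{ad}^*_\zeta\,\mu=\xi\,\mu$. (3) There exist $\zeta\in\mathfrak{g}$, $\eta\in\mathfrak{g}\setminus\{0\}$, and $\xi\in\mathbb{R}\setminus\{0\}$ such that $\mathrm{ad}_\zeta\,\eta=\xi\,\eta$ (such a $\zeta$ is called a hyperbolic element of $\mathfrak{g}$). Moreover, when these conditions hold, with $\zeta,\mu,\xi$ as in (2), the linear Hamiltonian $H_\zeta(\nu)=\langle\nu,\zeta\rangle$ realises condition (1) with $\mu_e=\mu$ as the conformal relative equilibrium and velocity $\xi$; furthermore $H_\zeta(\mu_e)=0$.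
   Context: $\langle\cdot,\cdot\rangle$ is the natural pairing of $\mathfrak{g}^*$ with $\mathfrak{g}$. For $\zeta\in\mathfrak{g}$, $\mathrm{ad}_\zeta\eta=[\zeta,\eta]$, and $\mathrm{ad}^*_\zeta:\mathfrak{g}^*\to\mathfrak{g}^*$ is defined by $\langle\mathrm{ad}^*_\zeta\mu,\eta\rangle=-\langle\mu,[\zeta,\eta]\rangle$ for all $\eta\in\mathfrak{g}$. The Lie--Poisson bracket is $\{f,g\}(\mu)=\langle\mu,[df(\mu),dg(\mu)]\rangle$ with $df(\mu)\in T^*_\mu\mathfrak{g}^*\cong\mathfrak{g}$, and the Hamiltonian vector field of $H\in C^\infty(\mathfrak{g}^* )$ is, by convention, $X_H(\mu)=\mathrm{ad}^*_{dH(\mu)}\mu$. $H$ is homogeneous of degree $b\in\mathbb{R}$ if $H(s\mu)=s^bH(\mu)$ for all $s>0$ and $\mu\in\mathfrak{g}^*$. A point $\mu_e\in\mathfrak{g}^*$ is a conformal relative equilibrium for $H$ with velocity $\xi\in\mathbb{R}$ if $X_H(\mu_e)=\xi\,\mu_e$ (the right-hand side being the infinitesimal generator of the scaling action corresponding to $\xi$, evaluated at $\mu_e$); it is nontrivial if $\mu_e\ne0$ and $\xi\neq0$. *)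

theory Defs
  imports "HOL-Analysis.Analysis"
begin

section \<open>Finite-dimensional real Lie algebras\<close>

text \<open>
  A finite-dimensional real vector space is modelled by a real normed space spanned by a finite set
  (the trivial space is included). The norm only provides the canonical topology, with respect to
  which every linear functional is continuous; hence the linear dual is the type of bounded
  linear functionals, and the natural pairing is \<^const>\<open>blinfun_apply\<close>.
\<close>

type_synonym 'g dual = "'g \<Rightarrow>\<^sub>L real"

locale fin_dim_lie_algebra =
  fixes br :: "'g::real_normed_vector \<Rightarrow> 'g \<Rightarrow> 'g"
  assumes fin_dim: "\<exists>B::'g set. finite B \<and> span B = UNIV"
    and bilinear_br: "bilinear br"
    and alternating: "br x x = 0"
    and jacobi: "br x (br y z) + br y (br z x) + br z (br x y) = 0"

definition ad :: "('g \<Rightarrow> 'g \<Rightarrow> 'g) \<Rightarrow> 'g \<Rightarrow> 'g \<Rightarrow> 'g"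
  where "ad br \<zeta> \<eta> = br \<zeta> \<eta>"

definition ad_star :: "('g::real_normed_vector \<Rightarrow> 'g \<Rightarrow> 'g) \<Rightarrow> 'g \<Rightarrow> 'g dual \<Rightarrow> 'g dual"
  where "ad_star br \<zeta> \<mu> = Blinfun (\<lambda>\<eta>. - blinfun_apply \<mu> (br \<zeta> \<eta>))"


section \<open>Functions on the dual\<close>

text \<open>
  \<^term>\<open>C_k k f\<close>: on a finite-dimensional space, being k times continuously Frechet differentiable
  is the same as iterated differentiability with all k-fold directional derivatives continuous.
\<close>

primrec C_k :: "nat \<Rightarrow> ('a::real_normed_vector \<Rightarrow> 'b::real_normed_vector) \<Rightarrow> bool" where
  "C_k 0 f \<longleftrightarrow> continuous_on UNIV f"
| "C_k (Suc k) f \<longleftrightarrow>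
     (\<forall>x. f differentiable (at x)) \<and> (\<forall>v. C_k k (\<lambda>x. frechet_derivative f (at x) v))"

definition smooth :: "('a::real_normed_vector \<Rightarrow> 'b::real_normed_vector) \<Rightarrow> bool"
  where "smooth f \<longleftrightarrow> (\<forall>k. C_k k f)"

text \<open>
  The differential at \<open>\<mu>\<close> as an element of \<open>\<gg>\<close>, through the identification of the bidual with \<open>\<gg>\<close>:
  the unique \<open>\<zeta>\<close> for which the derivative of \<open>f\<close> at \<open>\<mu>\<close> is evaluation at \<open>\<zeta>\<close>.
\<close>

definition differential :: "('g::real_normed_vector dual \<Rightarrow> real) \<Rightarrow> 'g dual \<Rightarrow> 'g"
  where "differential f \<mu> = (THE \<zeta>. (f has_derivative (\<lambda>\<nu>. blinfun_apply \<nu> \<zeta>)) (at \<mu>))"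

definition lie_poisson ::
  "('g::real_normed_vector \<Rightarrow> 'g \<Rightarrow> 'g) \<Rightarrow> ('g dual \<Rightarrow> real) \<Rightarrow> ('g dual \<Rightarrow> real) \<Rightarrow> 'g dual \<Rightarrow> real"
  where "lie_poisson br f g \<mu> = blinfun_apply \<mu> (br (differential f \<mu>) (differential g \<mu>))"

definition hamiltonian_vf ::
  "('g::real_normed_vector \<Rightarrow> 'g \<Rightarrow> 'g) \<Rightarrow> ('g dual \<Rightarrow> real) \<Rightarrow> 'g dual \<Rightarrow> 'g dual"
  where "hamiltonian_vf br H \<mu> = ad_star br (differential H \<mu>) \<mu>"

definition scaling :: "real \<Rightarrow> 'g::real_normed_vector dual \<Rightarrow> 'g dual"
  where "scaling s \<mu> = s *\<^sub>R \<mu>"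

definition homogeneous :: "('g::real_normed_vector dual \<Rightarrow> real) \<Rightarrow> real \<Rightarrow> bool"
  where "homogeneous H b \<longleftrightarrow> (\<forall>s>0. \<forall>\<mu>. H (scaling s \<mu>) = s powr b * H \<mu>)"

text \<open>
  The right-hand side \<open>\<xi> \<mu>\<close> is the value at \<open>\<mu>\<close> of the infinitesimal generator of the scaling
  action corresponding to \<open>\<xi>\<close>, see \<open>scaling_generator\<close> below.
\<close>

definition conformal_relative_equilibrium ::
  "('g::real_normed_vector \<Rightarrow> 'g \<Rightarrow> 'g) \<Rightarrow> ('g dual \<Rightarrow> real) \<Rightarrow> 'g dual \<Rightarrow> real \<Rightarrow> bool"
  where "conformal_relative_equilibrium br H \<mu> \<xi> \<longleftrightarrow> hamiltonian_vf br H \<mu> = \<xi> *\<^sub>R \<mu>"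

definition nontrivial_conformal_relative_equilibrium ::
  "('g::real_normed_vector \<Rightarrow> 'g \<Rightarrow> 'g) \<Rightarrow> ('g dual \<Rightarrow> real) \<Rightarrow> 'g dual \<Rightarrow> real \<Rightarrow> bool"
  where "nontrivial_conformal_relative_equilibrium br H \<mu> \<xi> \<longleftrightarrow>
    conformal_relative_equilibrium br H \<mu> \<xi> \<and> \<mu> \<noteq> 0 \<and> \<xi> \<noteq> 0"

definition linear_hamiltonian :: "'g::real_normed_vector \<Rightarrow> 'g dual \<Rightarrow> real"
  where "linear_hamiltonian \<zeta> \<nu> = blinfun_apply \<nu> \<zeta>"


section \<open>The definitions mean what they should\<close>

lemma scaling_generator:
  "((\<lambda>t. scaling (exp (t * \<xi>)) \<mu>) has_vector_derivative \<xi> *\<^sub>R \<mu>) (at 0)"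
  unfolding scaling_def
  by (auto intro!: derivative_eq_intros simp: has_vector_derivative_def fun_eq_iff)

lemma fin_dim_coordinates_bounded:
  fixes B :: "'a::real_normed_vector set"
  assumes fin: "finite B" and ind: "independent B"
  obtains c where "c > 0" "\<And>u. c * (\<Sum>b\<in>B. \<bar>u b\<bar>) \<le> norm (\<Sum>b\<in>B. u b *\<^sub>R b)"
proof (cases "B = {}")
  case True
  then show ?thesis using that[of 1] by simp
next
  case False
  define P :: "('a \<Rightarrow> real) set" where "P = (\<Pi>\<^sub>E x\<in>UNIV. if x \<in> B then {-1..1} else {0})"
  define K where "K = P \<inter> {u. (\<Sum>b\<in>B. \<bar>u b\<bar>) = 1}"
  define \<phi> where "\<phi> = (\<lambda>u::'a \<Rightarrow> real. norm (\<Sum>b\<in>B. u b *\<^sub>R b))"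
  have "compactin (product_topology (\<lambda>_::'a. euclidean::real topology) UNIV) P"
    unfolding P_def by (subst compactin_PiE) auto
  then have "compact P" by (simp add: euclidean_product_topology)
  moreover have "closed {u::'a \<Rightarrow> real. (\<Sum>b\<in>B. \<bar>u b\<bar>) = 1}"
    by (intro closed_Collect_eq continuous_intros continuous_on_product_coordinates)
  ultimately have K: "compact K" unfolding K_def by (rule compact_Int_closed)
  have cont: "continuous_on K \<phi>"
    unfolding \<phi>_def
    by (intro continuous_intros continuous_on_subset[OF continuous_on_product_coordinates]) auto
  obtain b0 where b0: "b0 \<in> B" using False by auto
  have "(\<lambda>x. if x = b0 then 1 else 0) \<in> K"
    using b0 fin by (auto simp: K_def P_def if_distrib cong: if_cong)
  then have "K \<noteq> {}" by auto
  then obtain u0 where u0: "u0 \<in> K" "\<And>u. u \<in> K \<Longrightarrow> \<phi> u0 \<le> \<phi> u"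
    using continuous_attains_inf[OF K _ cont] by blast
  have pos: "\<phi> u0 > 0"
  proof (rule ccontr)
    assume "\<not> \<phi> u0 > 0"
    then have "(\<Sum>b\<in>B. u0 b *\<^sub>R b) = 0" by (simp add: \<phi>_def)
    then have "\<forall>b\<in>B. u0 b = 0"
      using ind fin independentD by blast
    then show False using u0(1) by (simp add: K_def)
  qed
  show ?thesis
  proof (rule that[OF pos])
    fix u :: "'a \<Rightarrow> real"
    define s where "s = (\<Sum>b\<in>B. \<bar>u b\<bar>)"
    show "\<phi> u0 * (\<Sum>b\<in>B. \<bar>u b\<bar>) \<le> norm (\<Sum>b\<in>B. u b *\<^sub>R b)"
    proof (cases "s = 0")
      case True
      then show ?thesis by (simp add: s_def)
    next
      case False
      then have s: "s > 0" unfolding s_def by (simp add: sum_nonneg order_less_le)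
      define w where "w = (\<lambda>x. if x \<in> B then u x / s else 0)"
      have "\<bar>u b\<bar> \<le> s" if "b \<in> B" for b
        unfolding s_def using that fin by (intro member_le_sum) auto
      then have le: "u b \<le> s" "- s \<le> u b" if "b \<in> B" for b
        using that by (fastforce simp: abs_le_iff)+
      have sm: "(\<Sum>b\<in>B. \<bar>w b\<bar>) = 1"
      proof -
        have "(\<Sum>b\<in>B. \<bar>w b\<bar>) = (\<Sum>b\<in>B. \<bar>u b\<bar> / s)"
          using s by (intro sum.cong) (auto simp: w_def)
        also have "\<dots> = s / s" unfolding s_def by (rule sum_divide_distrib[symmetric])
        finally show ?thesis using s by simp
      qed
      have "w \<in> P"
        using le s by (auto simp: P_def w_def field_simps)
      then have "\<phi> u0 \<le> \<phi> w" using u0(2) sm by (simp add: K_def)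
      also have "\<phi> w = norm ((1 / s) *\<^sub>R (\<Sum>b\<in>B. u b *\<^sub>R b))"
        unfolding \<phi>_def scaleR_sum_right
        by (intro arg_cong[where f = norm] sum.cong) (auto simp: w_def)
      also have "\<dots> = norm (\<Sum>b\<in>B. u b *\<^sub>R b) / s" using s by simp
      finally show ?thesis using s by (simp add: s_def[symmetric] field_simps)
    qed
  qed
qed

lemma fin_dim_linear_imp_bounded_linear:
  fixes f :: "'a::real_normed_vector \<Rightarrow> 'b::real_normed_vector"
  assumes fd: "\<exists>B::'a set. finite B \<and> span B = UNIV" and lin: "linear f"
  shows "bounded_linear f"
proof -
  obtain B0 :: "'a set" where B0: "finite B0" "span B0 = UNIV" using fd by blast
  obtain B where B: "B \<subseteq> B0" "independent B" "B0 \<subseteq> span B"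
    using maximal_independent_subset by blast
  have fin: "finite B" using B B0 finite_subset by blast
  have sp: "span B = UNIV" using B B0 by (metis span_mono span_span top.extremum_unique)
  obtain c where c: "c > 0" "\<And>u. c * (\<Sum>b\<in>B. \<bar>u b\<bar>) \<le> norm (\<Sum>b\<in>B. u b *\<^sub>R b)"
    using fin_dim_coordinates_bounded[OF fin B(2)] by blast
  define M where "M = (\<Sum>b\<in>B. norm (f b))"
  show ?thesis
  proof (rule bounded_linear_intro[where K = "M / c"])
    show "f (x + y) = f x + f y" for x y using lin by (rule linear_add)
    show "f (r *\<^sub>R x) = r *\<^sub>R f x" for r x using lin by (rule linear_scale)
    fix x
    have "x \<in> range (\<lambda>u. \<Sum>b\<in>B. u b *\<^sub>R b)" using sp fin by (simp add: span_finite)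
    then obtain u where x: "x = (\<Sum>b\<in>B. u b *\<^sub>R b)" by blast
    have "norm (f x) = norm (\<Sum>b\<in>B. u b *\<^sub>R f b)"
      by (simp add: x linear_sum[OF lin] linear_scale[OF lin])
    also have "\<dots> \<le> (\<Sum>b\<in>B. \<bar>u b\<bar> * norm (f b))"
      by (rule order_trans[OF norm_sum]) simp
    also have "\<dots> \<le> (\<Sum>b\<in>B. \<bar>u b\<bar> * M)"
      unfolding M_def by (intro sum_mono mult_left_mono member_le_sum) (auto simp: fin)
    also have "\<dots> = (\<Sum>b\<in>B. \<bar>u b\<bar>) * M" by (simp add: sum_distrib_right)
    also have "\<dots> \<le> (norm x / c) * M"
      using c(1) c(2)[of u]
      by (intro mult_right_mono) (auto simp: x M_def field_simps sum_nonneg)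
    finally show "norm (f x) \<le> norm x * (M / c)" by simp
  qed
qed

context fin_dim_lie_algebra
begin

lemma ad_star_apply: "blinfun_apply (ad_star br \<zeta> \<mu>) \<eta> = - blinfun_apply \<mu> (br \<zeta> \<eta>)"
proof -
  have "linear (br \<zeta>)" using bilinear_br by (simp add: bilinear_def)
  then have "linear (\<lambda>\<eta>. - blinfun_apply \<mu> (br \<zeta> \<eta>))"
    by (simp add: linear_iff blinfun.add_right blinfun.scaleR_right)
  then have "bounded_linear (\<lambda>\<eta>. - blinfun_apply \<mu> (br \<zeta> \<eta>))"
    by (rule fin_dim_linear_imp_bounded_linear[OF fin_dim])
  then show ?thesis by (simp add: ad_star_def bounded_linear_Blinfun_apply)
qed

lemma bidual_ex1:
  fixes D :: "'g dual \<Rightarrow> real"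
  assumes "linear D"
  shows "\<exists>!\<zeta>. \<forall>\<nu>. D \<nu> = blinfun_apply \<nu> \<zeta>"
proof -
  obtain B0 :: "'g set" where B0: "finite B0" "span B0 = UNIV" using fin_dim by blast
  obtain B where B: "B \<subseteq> B0" "independent B" "B0 \<subseteq> span B"
    using maximal_independent_subset by blast
  have fin: "finite B" using B B0 finite_subset by blast
  have sp: "span B = UNIV" using B B0 by (metis span_mono span_span top.extremum_unique)
  define e :: "'g \<Rightarrow> 'g dual" where "e = (\<lambda>b. Blinfun (\<lambda>x. representation B x b))"
  have e: "blinfun_apply (e b) x = representation B x b" for b x
  proof -
    have "linear (\<lambda>x. representation B x b)"
      using B(2) sp by (auto intro!: linearI simp: representation_add representation_scale)
    then have "bounded_linear (\<lambda>x. representation B x b)"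
      by (rule fin_dim_linear_imp_bounded_linear[OF fin_dim])
    then show ?thesis by (simp add: e_def bounded_linear_Blinfun_apply)
  qed
  have rep: "x = (\<Sum>b\<in>B. blinfun_apply (e b) x *\<^sub>R b)" for x
    using sum_representation_eq[OF B(2) _ fin order_refl, of x] sp by (simp add: e)
  have dual_rep: "\<nu> = (\<Sum>b\<in>B. blinfun_apply \<nu> b *\<^sub>R e b)" for \<nu>
  proof (rule blinfun_eqI)
    fix x
    have "blinfun_apply \<nu> x = blinfun_apply \<nu> (\<Sum>b\<in>B. blinfun_apply (e b) x *\<^sub>R b)"
      using rep by metis
    also have "\<dots> = (\<Sum>b\<in>B. blinfun_apply (e b) x * blinfun_apply \<nu> b)"
      by (simp add: blinfun.sum_right blinfun.scaleR_right)
    finally show "blinfun_apply \<nu> x = blinfun_apply (\<Sum>b\<in>B. blinfun_apply \<nu> b *\<^sub>R e b) x"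
      by (simp add: blinfun.sum_left blinfun.scaleR_left mult.commute)
  qed
  show ?thesis
  proof (rule ex1I)
    show "\<forall>\<nu>. D \<nu> = blinfun_apply \<nu> (\<Sum>b\<in>B. D (e b) *\<^sub>R b)"
    proof
      fix \<nu>
      have "D \<nu> = D (\<Sum>b\<in>B. blinfun_apply \<nu> b *\<^sub>R e b)" using dual_rep by metis
      also have "\<dots> = (\<Sum>b\<in>B. blinfun_apply \<nu> b * D (e b))"
        by (simp add: linear_sum[OF assms] linear_scale[OF assms])
      finally show "D \<nu> = blinfun_apply \<nu> (\<Sum>b\<in>B. D (e b) *\<^sub>R b)"
        by (simp add: blinfun.sum_right blinfun.scaleR_right mult.commute)
    qed
  next
    fix \<zeta> assume "\<forall>\<nu>. D \<nu> = blinfun_apply \<nu> \<zeta>"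
    then show "\<zeta> = (\<Sum>b\<in>B. D (e b) *\<^sub>R b)" using rep[of \<zeta>] by simp
  qed
qed

lemma has_derivative_differential:
  fixes f :: "'g dual \<Rightarrow> real"
  assumes "f differentiable (at \<mu>)"
  shows "(f has_derivative (\<lambda>\<nu>. blinfun_apply \<nu> (differential f \<mu>))) (at \<mu>)"
proof -
  obtain D where D: "(f has_derivative D) (at \<mu>)" using assms by (auto simp: differentiable_def)
  then have "linear D" by (rule has_derivative_linear)
  then obtain \<zeta> where \<zeta>: "D = (\<lambda>\<nu>. blinfun_apply \<nu> \<zeta>)"
    and uniq: "\<And>\<zeta>'. D = (\<lambda>\<nu>. blinfun_apply \<nu> \<zeta>') \<Longrightarrow> \<zeta>' = \<zeta>"
    using bidual_ex1 by (metis ext)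
  show ?thesis
    unfolding differential_def
  proof (rule theI)
    show "(f has_derivative (\<lambda>\<nu>. blinfun_apply \<nu> \<zeta>)) (at \<mu>)" using D \<zeta> by simp
  next
    fix \<zeta>' assume "(f has_derivative (\<lambda>\<nu>. blinfun_apply \<nu> \<zeta>')) (at \<mu>)"
    then show "\<zeta>' = \<zeta>" using D has_derivative_unique uniq by blast
  qed
qed

text \<open>\<open>X\<^sub>H\<close> is the Hamiltonian vector field of the Lie--Poisson bracket: \<open>X\<^sub>H f = {f, H}\<close>.\<close>

lemma hamiltonian_vf_lie_poisson:
  fixes f :: "'g dual \<Rightarrow> real"
  assumes "(f has_derivative D) (at \<mu>)"
  shows "D (hamiltonian_vf br H \<mu>) = lie_poisson br f H \<mu>"
proof -
  have "D = (\<lambda>\<nu>. blinfun_apply \<nu> (differential f \<mu>))"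
    using assms has_derivative_differential has_derivative_unique differentiableI by blast
  moreover have "br (x + y) (x + y) = br x x + br x y + (br y x + br y y)" for x y
    by (simp add: bilinear_ladd[OF bilinear_br] bilinear_radd[OF bilinear_br] algebra_simps)
  then have "br x y = - br y x" for x y by (simp add: alternating eq_neg_iff_add_eq_0)
  ultimately show ?thesis
    unfolding hamiltonian_vf_def lie_poisson_def
    by (metis ad_star_apply blinfun.minus_right)
qed

end

end

(*
The linear endomorphism eta |-> [zeta, eta] - c eta of the finite-dimensional space g is injective
iff it is surjective, and it fails to be surjective iff some nonzero functional vanishes on its
range. Hence ad_zeta and its transpose have the same real eigenvalues; as ad*_zeta is minus the
transpose, passing between (2) and (3) keeps zeta and replaces xi by -xi. Condition (1) for H gives
(2) with zeta = dH(mu_e), and linear Hamiltonians give the converse.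
*)
theory Submission
  imports Defs
begin

text \<open>This is rank-nullity for endomorphisms. Finite dimension is a hypothesis here rather
  than a type class, so the facts are imported by thinning the finite spanning set to a basis and
  interpreting \<open>finite_dimensional_vector_space\<close> at it.\<close>

lemma fin_dim_linear_inj_iff_surj:
  fixes f :: "'a::real_normed_vector \<Rightarrow> 'a"
  assumes fd: "\<exists>B::'a set. finite B \<and> span B = UNIV" and lin: "linear f"
  shows "inj f \<longleftrightarrow> surj f"
proof -
  obtain B0 :: "'a set" where B0: "finite B0" "span B0 = UNIV" using fd by blast
  obtain B where B: "B \<subseteq> B0" "independent B" "B0 \<subseteq> span B"
    using maximal_independent_subset by blast
  have fin: "finite B" using B B0 finite_subset by blast
  have sp: "span B = UNIV" using B B0 by (metis span_mono span_span top.extremum_unique)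
  interpret fd: finite_dimensional_vector_space "scaleR :: real \<Rightarrow> 'a \<Rightarrow> 'a" B
    by unfold_locales
      (use fin B(2) sp in \<open>simp_all add: dependent_raw_def span_raw_def algebra_simps\<close>)
  have "Vector_Spaces.linear scaleR scaleR f" using lin by (simp add: linear_def)
  then show ?thesis using fd.linear_inj_imp_surj fd.linear_surj_imp_inj by blast
qed

text \<open>A basis \<open>C\<close> of \<open>W\<close> stays independent after adding some
  \<open>a\<close> outside \<open>W\<close>, so a linear functional may be prescribed as 1 at
  \<open>a\<close> and 0 on \<open>C\<close>. Finite dimension makes it bounded, hence an element of
  \<open>'a dual\<close>.\<close>

lemma proper_subspace_annihilator:
  fixes W :: "'a::real_normed_vector set"
  assumes fd: "\<exists>B::'a set. finite B \<and> span B = UNIV" and W: "subspace W" "W \<noteq> UNIV"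
  obtains \<mu> :: "'a dual" where "\<mu> \<noteq> 0" "\<And>w. w \<in> W \<Longrightarrow> blinfun_apply \<mu> w = 0"
proof -
  obtain a where a: "a \<notin> W" using W(2) by blast
  obtain C where C: "C \<subseteq> W" "independent C" "W \<subseteq> span C"
    using maximal_independent_subset by blast
  have W_eq: "W = span C" using C W(1) by (simp add: span_subspace)
  have "independent (insert a C)" using a C(2) W_eq by (simp add: independent_insertI)
  from linear_independent_extend[OF this, of "\<lambda>x. if x = a then 1 else 0"]
  obtain g :: "'a \<Rightarrow> real" where g: "linear g" "\<forall>x\<in>insert a C. g x = (if x = a then 1 else 0)"
    by blast
  have "a \<notin> C" using a C(1) by blast
  then have "g x = 0" if "x \<in> C" for x using that g(2) by auto
  then have g0: "g w = 0" if "w \<in> W" for w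
    using that linear_eq_0_on_span[OF g(1)] W_eq by blast
  have app: "blinfun_apply (Blinfun g) = g"
    by (rule bounded_linear_Blinfun_apply[OF fin_dim_linear_imp_bounded_linear[OF fd g(1)]])
  have "g a = 1" using g(2) by simp
  then have "Blinfun g \<noteq> 0" using app by (metis blinfun.zero_left zero_neq_one)
  then show thesis using that g0 app by metis
qed

lemma fin_dim_eigenvalue_iff_transpose:
  fixes A :: "'a::real_normed_vector \<Rightarrow> 'a"
  assumes fd: "\<exists>B::'a set. finite B \<and> span B = UNIV" and A: "linear A"
  shows "(\<exists>\<eta>. \<eta> \<noteq> 0 \<and> A \<eta> = c *\<^sub>R \<eta>)
    \<longleftrightarrow> (\<exists>\<mu>::'a dual. \<mu> \<noteq> 0 \<and> (\<forall>\<eta>. blinfun_apply \<mu> (A \<eta>) = c * blinfun_apply \<mu> \<eta>))"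
proof -
  \<comment> \<open>The left side says that \<open>T\<close> has a nonzero kernel, the right side
    that a nonzero functional kills its range.\<close>
  define T where "T = (\<lambda>\<eta>. A \<eta> - c *\<^sub>R \<eta>)"
  have T: "linear T"
    using A by (auto simp: T_def linear_iff algebra_simps)
  have "(\<exists>\<eta>. \<eta> \<noteq> 0 \<and> A \<eta> = c *\<^sub>R \<eta>) \<longleftrightarrow> \<not> inj T"
    using linear_injective_0[OF T] by (auto simp: T_def)
  also have "\<dots> \<longleftrightarrow> \<not> surj T" using fin_dim_linear_inj_iff_surj[OF fd T] by simp
  also have "\<dots> \<longleftrightarrow> (\<exists>\<mu>::'a dual. \<mu> \<noteq> 0 \<and> (\<forall>\<eta>. blinfun_apply \<mu> (T \<eta>) = 0))"
  proof
    assume "\<not> surj T"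
    moreover have "subspace (range T)" using T by (simp add: linear_subspace_image)
    ultimately obtain \<mu> :: "'a dual" where "\<mu> \<noteq> 0" "\<And>w. w \<in> range T \<Longrightarrow> blinfun_apply \<mu> w = 0"
      using proper_subspace_annihilator[OF fd] by metis
    then show "\<exists>\<mu>::'a dual. \<mu> \<noteq> 0 \<and> (\<forall>\<eta>. blinfun_apply \<mu> (T \<eta>) = 0)" by blast
  next
    assume "\<exists>\<mu>::'a dual. \<mu> \<noteq> 0 \<and> (\<forall>\<eta>. blinfun_apply \<mu> (T \<eta>) = 0)"
    then obtain \<mu> :: "'a dual" where \<mu>: "\<mu> \<noteq> 0" "\<And>\<eta>. blinfun_apply \<mu> (T \<eta>) = 0" by blast
    show "\<not> surj T"
    proof
      assume "surj T"
      then have "blinfun_apply \<mu> x = blinfun_apply 0 x" for x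
        using \<mu>(2) by (metis surjD blinfun.zero_left)
      then show False using \<mu>(1) blinfun_eqI by blast
    qed
  qed
  finally show ?thesis by (simp add: T_def blinfun.diff_right blinfun.scaleR_right)
qed

text \<open>The derivative of a constant in any direction is the constant 0, so the induction has to
  range over all constants.\<close>

lemma C_k_const: "C_k k (\<lambda>x::'a::real_normed_vector. c::'b::real_normed_vector)"
  by (induction k arbitrary: c) simp_all

text \<open>The derivative at every point is \<open>f\<close> itself, so each directional derivative
  is constant in the base point. Hence a case split on \<open>k\<close> suffices: continuity for 0,
  and \<open>C_k_const\<close> for successors.\<close>

lemma smooth_bounded_linear:
  assumes "bounded_linear f"
  shows "smooth f"
  unfolding smooth_def
proof
  have D: "(f has_derivative f) (at x)" for x
    using assms by (rule bounded_linear_imp_has_derivative)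
  have "frechet_derivative f (at x) = f" for x
    using frechet_derivative_at[OF D] by simp
  then show "C_k k f" for k
    using assms D by (cases k) (auto simp: C_k_const differentiable_def linear_continuous_on)
qed

lemma bounded_linear_linear_hamiltonian: "bounded_linear (linear_hamiltonian \<zeta>)"
  unfolding linear_hamiltonian_def[abs_def] by (rule blinfun.bounded_linear_left)

lemma homogeneous_linear_hamiltonian: "homogeneous (linear_hamiltonian \<zeta>) 1"
  by (simp add: homogeneous_def scaling_def linear_hamiltonian_def blinfun.scaleR_left)

context fin_dim_lie_algebra
begin

text \<open>A bounded linear map is its own derivative, so the same functional on the dual is
  evaluation at \<open>\<zeta>\<close> and evaluation at the differential. The uniqueness part of
  \<open>bidual_ex1\<close> identifies the two vectors.\<close>

lemma differential_linear_hamiltonian: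
  fixes \<zeta> :: 'g
  shows "differential (linear_hamiltonian \<zeta>) \<mu> = \<zeta>"
proof -
  have D: "(linear_hamiltonian \<zeta> has_derivative linear_hamiltonian \<zeta>) (at \<mu>)"
    by (rule bounded_linear_imp_has_derivative[OF bounded_linear_linear_hamiltonian])
  have "linear_hamiltonian \<zeta>
      = (\<lambda>\<nu>. blinfun_apply \<nu> (differential (linear_hamiltonian \<zeta>) \<mu>))"
    by (rule has_derivative_unique[OF D has_derivative_differential[OF differentiableI[OF D]]])
  then have "\<forall>\<nu>. linear_hamiltonian \<zeta> \<nu>
      = blinfun_apply \<nu> (differential (linear_hamiltonian \<zeta>) \<mu>)"
    by (rule fun_cong[THEN allI])
  moreover have "\<forall>\<nu>. linear_hamiltonian \<zeta> \<nu> = blinfun_apply \<nu> \<zeta>"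
    by (simp add: linear_hamiltonian_def)
  ultimately show ?thesis
    using bidual_ex1[OF bounded_linear.linear[OF bounded_linear_linear_hamiltonian]] by blast
qed

text \<open>Testing against every \<open>\<eta>\<close> brings the equation into the transpose form
  of \<open>fin_dim_eigenvalue_iff_transpose\<close> with \<open>c = - \<xi>\<close>; the sign comes
  from the definition of \<open>ad_star\<close>.\<close>

lemma ad_star_eigenvector_iff:
  "ad_star br \<zeta> \<mu> = \<xi> *\<^sub>R \<mu>
    \<longleftrightarrow> (\<forall>\<eta>. blinfun_apply \<mu> (br \<zeta> \<eta>) = (- \<xi>) * blinfun_apply \<mu> \<eta>)"
proof -
  have "ad_star br \<zeta> \<mu> = \<xi> *\<^sub>R \<mu>
    \<longleftrightarrow> (\<forall>\<eta>. blinfun_apply (ad_star br \<zeta> \<mu>) \<eta> = blinfun_apply (\<xi> *\<^sub>R \<mu>) \<eta>)"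
    by (metis blinfun_eqI)
  moreover have "- x = \<xi> * y \<longleftrightarrow> x = (- \<xi>) * y" for x y by auto
  ultimately show ?thesis by (simp add: ad_star_apply blinfun.scaleR_left)
qed

lemma ex_ad_star_eigenvector_iff:
  "(\<exists>\<mu>. \<mu> \<noteq> 0 \<and> ad_star br \<zeta> \<mu> = \<xi> *\<^sub>R \<mu>) \<longleftrightarrow> (\<exists>\<eta>. \<eta> \<noteq> 0 \<and> ad br \<zeta> \<eta> = (- \<xi>) *\<^sub>R \<eta>)"
proof -
  have "linear (br \<zeta>)" using bilinear_br by (simp add: bilinear_def)
  from fin_dim_eigenvalue_iff_transpose[OF fin_dim this, of "- \<xi>"]
  show ?thesis by (simp only: ad_star_eigenvector_iff ad_def)
qed

text \<open>Pair the eigenvector equation with \<open>\<zeta>\<close> itself: the bracket of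
  \<open>\<zeta>\<close> with itself vanishes, and the nonzero factor \<open>- \<xi>\<close>
  cancels. This is the vanishing of the linear Hamiltonian at the equilibrium.\<close>

lemma ad_star_eigenvector_apply_eq_0:
  assumes "ad_star br \<zeta> \<mu> = \<xi> *\<^sub>R \<mu>" "\<xi> \<noteq> 0"
  shows "blinfun_apply \<mu> \<zeta> = 0"
proof -
  have "blinfun_apply \<mu> (br \<zeta> \<zeta>) = (- \<xi>) * blinfun_apply \<mu> \<zeta>"
    using assms(1) ad_star_eigenvector_iff by blast
  then show ?thesis using assms(2) by (simp add: alternating blinfun.zero_right)
qed

lemma linear_hamiltonian_equilibrium:
  assumes "ad_star br \<zeta> \<mu> = \<xi> *\<^sub>R \<mu>" "\<mu> \<noteq> 0" "\<xi> \<noteq> 0"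
  shows "nontrivial_conformal_relative_equilibrium br (linear_hamiltonian \<zeta>) \<mu> \<xi>"
  using assms
  by (simp add: nontrivial_conformal_relative_equilibrium_def conformal_relative_equilibrium_def
      hamiltonian_vf_def differential_linear_hamiltonian)

end

theorem proposition5p3:
  fixes br :: "'g::real_normed_vector \<Rightarrow> 'g \<Rightarrow> 'g"
  assumes "fin_dim_lie_algebra br"
  shows
    "((\<exists>H b \<mu>\<^sub>e \<xi>. smooth H \<and> homogeneous H b
          \<and> nontrivial_conformal_relative_equilibrium br H \<mu>\<^sub>e \<xi>)
       \<longleftrightarrow> (\<exists>\<zeta> \<mu> \<xi>. \<mu> \<noteq> 0 \<and> \<xi> \<noteq> 0 \<and> ad_star br \<zeta> \<mu> = \<xi> *\<^sub>R \<mu>))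
     \<and> ((\<exists>\<zeta> \<mu> \<xi>. \<mu> \<noteq> 0 \<and> \<xi> \<noteq> 0 \<and> ad_star br \<zeta> \<mu> = \<xi> *\<^sub>R \<mu>)
       \<longleftrightarrow> (\<exists>\<zeta> \<eta> \<xi>. \<eta> \<noteq> 0 \<and> \<xi> \<noteq> 0 \<and> ad br \<zeta> \<eta> = \<xi> *\<^sub>R \<eta>))
     \<and> (\<forall>\<zeta> \<mu> \<xi>. \<mu> \<noteq> 0 \<and> \<xi> \<noteq> 0 \<and> ad_star br \<zeta> \<mu> = \<xi> *\<^sub>R \<mu> \<longrightarrow>
          smooth (linear_hamiltonian \<zeta>)
          \<and> (\<exists>b. homogeneous (linear_hamiltonian \<zeta>) b)
          \<and> nontrivial_conformal_relative_equilibrium br (linear_hamiltonian \<zeta>) \<mu> \<xi>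
          \<and> linear_hamiltonian \<zeta> \<mu> = 0)"
proof -
  interpret fin_dim_lie_algebra br by (rule assms)
  \<comment> \<open>The final claim of the theorem comes first, because it also supplies the
    Hamiltonian for (2) implies (1).\<close>
  have real: "smooth (linear_hamiltonian \<zeta>)
      \<and> (\<exists>b. homogeneous (linear_hamiltonian \<zeta>) b)
      \<and> nontrivial_conformal_relative_equilibrium br (linear_hamiltonian \<zeta>) \<mu> \<xi>
      \<and> linear_hamiltonian \<zeta> \<mu> = 0"
    if "\<mu> \<noteq> 0" "\<xi> \<noteq> 0" "ad_star br \<zeta> \<mu> = \<xi> *\<^sub>R \<mu>" for \<zeta> \<mu> \<xi>
    using that smooth_bounded_linear[OF bounded_linear_linear_hamiltonian]
      homogeneous_linear_hamiltonian linear_hamiltonian_equilibrium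
      ad_star_eigenvector_apply_eq_0[of \<zeta> \<mu> \<xi>]
    by (auto simp: linear_hamiltonian_def[of \<zeta> \<mu>])
  have "(\<exists>H b \<mu>\<^sub>e \<xi>. smooth H \<and> homogeneous H b
          \<and> nontrivial_conformal_relative_equilibrium br H \<mu>\<^sub>e \<xi>)
       \<longleftrightarrow> (\<exists>\<zeta> \<mu> \<xi>. \<mu> \<noteq> 0 \<and> \<xi> \<noteq> 0 \<and> ad_star br \<zeta> \<mu> = \<xi> *\<^sub>R \<mu>)" (is "?C1 \<longleftrightarrow> ?C2")
  proof
    assume ?C1
    \<comment> \<open>Unfolding exhibits \<open>differential H \<mu>\<^sub>e\<close> as the required
      \<open>\<zeta>\<close>, with the same point and velocity.\<close>
    then show ?C2
      unfolding nontrivial_conformal_relative_equilibrium_def conformal_relative_equilibrium_def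
        hamiltonian_vf_def by blast
  next
    assume ?C2
    then show ?C1 using real by blast
  qed
  moreover have "?C2 \<longleftrightarrow> (\<exists>\<zeta> \<eta> \<xi>. \<eta> \<noteq> 0 \<and> \<xi> \<noteq> 0 \<and> ad br \<zeta> \<eta> = \<xi> *\<^sub>R \<eta>)" (is "_ \<longleftrightarrow> ?C3")
  proof
    assume ?C2
    then show ?C3 using ex_ad_star_eigenvector_iff by (metis neg_equal_0_iff_equal)
  next
    assume ?C3
    \<comment> \<open>The double negation matches the sign-reversing equivalence at
      \<open>- \<xi>\<close>, which becomes the nonzero eigenvalue in \<open>?C2\<close>.\<close>
    then obtain \<zeta> \<eta> \<xi> where "\<eta> \<noteq> 0" "\<xi> \<noteq> 0" "ad br \<zeta> \<eta> = (- (- \<xi>)) *\<^sub>R \<eta>" by auto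
    then show ?C2 using ex_ad_star_eigenvector_iff[of \<zeta> "- \<xi>"] by (metis neg_equal_0_iff_equal)
  qed
  ultimately show ?thesis using real by blast
qed

end
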